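(* Let $n\ge 2$ and let $\rho$ denote complex conjugation on $\mathbb{R}^{2n}\cong\mathbb{C}^n$. For every $C>0$ there exists a $\rho$-invariant starshaped domain $K\subset\mathbb{R}^{2n}$ with smooth boundary such that $$\mathfrak{R}(\partial K,\rho)>C .$$
   Context: Identify $\mathbb{C}^n$ with $\mathbb{R}^{2n}$ via $z_j=x_j+iy_j$ and let $\lambda_0=\tfrac12\sum_{j=1}^n(x_j\,dy_j-y_j\,dx_j)$. Complex conjugation is $\rho(x_1,y_1,\dots,x_n,y_n)=(x_1,-y_1,\dots,x_n,-y_n)$; it satisfies $\rho^*\lambda_0=-\lambda_0$. A starshaped domain with smooth boundary in $\mathbb{R}^{2n}$ is a compact domain $K$ with smooth boundary containing the origin in its interior such that the radial vector field is transverse to $\partial K$; then $\alpha=\lambda_0|_{\partial K}$ is a contact form on $\partial K$. For a contact form $\alpha$ on a closed connected manifold $\Sigma$, the Reeb vector field $R$ is determined by $d\alpha(R,\cdot)=0$, $\alpha(R)=1$. A periodic orbit of period $\tau>0$ is a smooth curve $\gamma:\mathbb{R}/\tau\mathbb{Z}\to\Sigma$ with $\dot\gamma=R\circ\gamma$. If $\rho$ is an involution of $\Sigma$ with $\rho^*\alpha=-\alpha$, $\gamma$ is symmetric if $\rho(\mathrm{Im}(\gamma))=\mathrm{Im}(\gamma)$. The systole $\ell_{\min}$ is the infimum of the periods of all periodic orbits, the symmetric systole $\ell_{\min}^{\mathrm{sym}}$ is the infimum of the periods of all symmetric periodic orbits (infimum of the empty set is $\infty$), and the symmetric ratio is $\mathfrak{R}=\ell_{\min}^{\mathrm{sym}}/\ell_{\min}$.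 Here $\mathfrak{R}(\partial K,\rho)$ is the symmetric ratio for $\Sigma=\partial K$, $\alpha=\lambda_0|_{\partial K}$ and the restriction of $\rho$ to $\partial K$. *)

theory Defs
  imports "HOL-Analysis.Analysis"
begin

(* C^k and C^\<infinity> maps on an open set S, through iterated directional
   derivatives. *)

primrec higher_differentiable_on ::
  "'a::real_normed_vector set \<Rightarrow> ('a \<Rightarrow> 'b::real_normed_vector) \<Rightarrow> nat \<Rightarrow> bool"
where
  "higher_differentiable_on S f 0 \<longleftrightarrow> continuous_on S f"
| "higher_differentiable_on S f (Suc k) \<longleftrightarrow>
     (\<forall>x\<in>S. f differentiable (at x)) \<and>
     (\<forall>v. higher_differentiable_on S (\<lambda>x. frechet_derivative f (at x) v) k)"

definition smooth_on ::
  "'a::real_normed_vector set \<Rightarrow> ('a \<Rightarrow> 'b::real_normed_vector) \<Rightarrow> bool"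
where
  "smooth_on S f \<longleftrightarrow> (\<forall>k. higher_differentiable_on S f k)"

(* Velocities at p of smooth curves in M; this is the usual tangent space when M
   is an embedded submanifold. *)
definition tangent_space :: "'a::real_normed_vector set \<Rightarrow> 'a \<Rightarrow> 'a set" where
  "tangent_space M p =
     {v. \<exists>\<gamma> \<epsilon>. 0 < \<epsilon> \<and> smooth_on {-\<epsilon><..<\<epsilon>} \<gamma> \<and> \<gamma> ` {-\<epsilon><..<\<epsilon>} \<subseteq> M \<and>
        \<gamma> 0 = p \<and> (\<gamma> has_vector_derivative v) (at (0::real))}"

definition smooth_compact_domain :: "'a::real_normed_vector set \<Rightarrow> bool" where
  "smooth_compact_domain K \<longleftrightarrow>
     compact K \<and> connected K \<and>
     (\<forall>p\<in>frontier K. \<exists>U f. open U \<and> p \<in> U \<and> smooth_on U (f :: 'a \<Rightarrow> real) \<and>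
        (\<exists>v. frechet_derivative f (at p) v \<noteq> 0) \<and>
        K \<inter> U = {x \<in> U. f x \<le> 0})"

(* The radial vector field has the value p at p, and a vector field is transverse
   to a hypersurface iff it is nowhere tangent to it. Connectedness of K excludes,
   e.g., the union of a ball with a disjoint concentric shell. *)
definition starshaped_domain :: "'a::real_normed_vector set \<Rightarrow> bool" where
  "starshaped_domain K \<longleftrightarrow>
     smooth_compact_domain K \<and> 0 \<in> interior K \<and>
     (\<forall>p\<in>frontier K. p \<notin> tangent_space (frontier K) p)"

(* A one-form on the ambient space is a function of a point and a vector; the
   form on a submanifold M is its restriction to tangent vectors of M. *)

type_synonym 'a one_form = "'a \<Rightarrow> 'a \<Rightarrow> real"

definition ext_deriv :: "'a::real_normed_vector one_form \<Rightarrow> 'a \<Rightarrow> 'a \<Rightarrow> 'a \<Rightarrow> real" where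
  "ext_deriv \<alpha> p u v =
     frechet_derivative (\<lambda>q. \<alpha> q v) (at p) u - frechet_derivative (\<lambda>q. \<alpha> q u) (at p) v"

(* The exterior derivative commutes with restriction, so d(\<alpha>|M) is the
   restriction of d\<alpha> to tangent vectors of M. *)
definition reeb :: "'a::real_normed_vector set \<Rightarrow> 'a one_form \<Rightarrow> 'a \<Rightarrow> 'a" where
  "reeb M \<alpha> p =
     (THE r. r \<in> tangent_space M p \<and>
        (\<forall>v\<in>tangent_space M p. ext_deriv \<alpha> p r v = 0) \<and> \<alpha> p r = 1)"

(* Curves on the circle R/\<tau>Z are \<tau>-periodic curves on R; \<tau> need not be the
   minimal period. *)
definition periodic_orbit ::
  "'a::real_normed_vector set \<Rightarrow> 'a one_form \<Rightarrow> real \<Rightarrow> (real \<Rightarrow> 'a) \<Rightarrow> bool"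
where
  "periodic_orbit M \<alpha> \<tau> \<gamma> \<longleftrightarrow>
     0 < \<tau> \<and> smooth_on UNIV \<gamma> \<and> range \<gamma> \<subseteq> M \<and> (\<forall>t. \<gamma> (t + \<tau>) = \<gamma> t) \<and>
     (\<forall>t. (\<gamma> has_vector_derivative reeb M \<alpha> (\<gamma> t)) (at t))"

definition symmetric_orbit :: "('a \<Rightarrow> 'a) \<Rightarrow> (real \<Rightarrow> 'a) \<Rightarrow> bool" where
  "symmetric_orbit \<rho> \<gamma> \<longleftrightarrow> \<rho> ` range \<gamma> = range \<gamma>"

definition systole :: "'a::real_normed_vector set \<Rightarrow> 'a one_form \<Rightarrow> ereal" where
  "systole M \<alpha> = Inf {ereal \<tau> | \<tau>. \<exists>\<gamma>. periodic_orbit M \<alpha> \<tau> \<gamma>}"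

definition symmetric_systole ::
  "'a::real_normed_vector set \<Rightarrow> 'a one_form \<Rightarrow> ('a \<Rightarrow> 'a) \<Rightarrow> ereal"
where
  "symmetric_systole M \<alpha> \<rho> =
     Inf {ereal \<tau> | \<tau>. \<exists>\<gamma>. periodic_orbit M \<alpha> \<tau> \<gamma> \<and> symmetric_orbit \<rho> \<gamma>}"

definition symmetric_ratio ::
  "'a::real_normed_vector set \<Rightarrow> 'a one_form \<Rightarrow> ('a \<Rightarrow> 'a) \<Rightarrow> ereal"
where
  "symmetric_ratio M \<alpha> \<rho> = symmetric_systole M \<alpha> \<rho> / systole M \<alpha>"

(* R^2n is modelled as C^n with its real structure, x_j = Re (z $ j) and
   y_j = Im (z $ j). *)

definition lambda0 :: "(complex ^ 'n::finite) one_form" where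
  "lambda0 z v = (1/2) * (\<Sum>j\<in>UNIV. Re (z $ j) * Im (v $ j) - Im (z $ j) * Re (v $ j))"

definition conjugation :: "complex ^ 'n::finite \<Rightarrow> complex ^ 'n" where
  "conjugation z = (\<chi> j. cnj (z $ j))"

end

theory Submission
  imports Defs
begin

text \<open>
  Let \<open>H z = \<bar>z\<bar>\<^sup>4 + B L\<^sup>2\<close> on \<open>\<complex>\<^sup>n\<close>, where \<open>L = x\<^sub>a y\<^sub>b - x\<^sub>b y\<^sub>a\<close> is an angular momentum, and
  let \<open>K = {H \<le> 1}\<close>. As \<open>H\<close> is homogeneous, the Reeb flow on the boundary is, up to the
  factor \<open>1/2\<close>, the Hamiltonian flow of \<open>H\<close>, which preserves \<open>L\<close>. Since \<open>L\<close> changes sign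
  under conjugation, a symmetric orbit lies in \<open>{L = 0}\<close>; there the flow is the Hopf flow
  \<open>z \<mapsto> e\<^sup>2\<^sup>i\<^sup>t z\<close>, so its period is at least \<open>\<pi>\<close>. On the other hand, the circle through a
  multiple of \<open>(1, i)\<close> in the coordinates \<open>a, b\<close>, where \<open>L\<close> is as large as possible, is a
  closed orbit of period \<open>2\<pi> / \<surd>(4 + B)\<close>.
\<close>

section \<open>Smooth maps\<close>

lemma higher_differentiable_on_subset:
  "higher_differentiable_on S f k \<Longrightarrow> T \<subseteq> S \<Longrightarrow> higher_differentiable_on T f k"
  by (induction k arbitrary: f) (auto intro: continuous_on_subset)

lemma smooth_on_subset: "smooth_on S f \<Longrightarrow> T \<subseteq> S \<Longrightarrow> smooth_on T f"
  by (auto simp: smooth_on_def intro: higher_differentiable_on_subset)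

lemma higher_differentiable_on_SucD:
  "higher_differentiable_on S f (Suc k) \<Longrightarrow> higher_differentiable_on S f k"
  by (induction k arbitrary: f)
     (auto intro: continuous_at_imp_continuous_on differentiable_imp_continuous_within)

text \<open>Derivatives are unique, so the operator \<open>frechet_derivative\<close> in the
  definition may be replaced by any explicit formula for the derivative; every induction on
  \<open>k\<close> below goes through this rule.\<close>

lemma higher_differentiable_on_SucI:
  assumes "\<And>x. (f has_derivative f' x) (at x)"
    and "\<And>v. higher_differentiable_on UNIV (\<lambda>x. f' x v) k"
  shows "higher_differentiable_on UNIV f (Suc k)"
proof -
  have "frechet_derivative f (at x) = f' x" for x
    using frechet_derivative_at[OF assms(1)] by simp
  then show ?thesis using assms by (auto simp: differentiable_def)
qed

lemma higher_differentiable_on_SucE: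
  assumes "higher_differentiable_on UNIV f (Suc k)"
  obtains f' where "\<And>x. (f has_derivative f' x) (at x)"
    and "\<And>v. higher_differentiable_on UNIV (\<lambda>x. f' x v) k"
  using assms by (intro that[of "\<lambda>x. frechet_derivative f (at x)"])
    (auto simp: frechet_derivative_works)

lemma higher_differentiable_on_const: "higher_differentiable_on UNIV (\<lambda>x. c) k"
proof (induction k arbitrary: c)
  case (Suc k)
  show ?case
    by (rule higher_differentiable_on_SucI[where f' = "\<lambda>x v. 0"]) (auto intro: Suc)
qed simp

lemma (in bounded_linear) higher_differentiable_on_compose:
  "higher_differentiable_on UNIV g k \<Longrightarrow> higher_differentiable_on UNIV (\<lambda>x. f (g x)) k"
proof (induction k arbitrary: g)
  case 0
  then show ?case by (auto intro: continuous_on)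
next
  case (Suc k)
  from Suc.prems obtain g' where g: "\<And>x. (g has_derivative g' x) (at x)"
      "\<And>v. higher_differentiable_on UNIV (\<lambda>x. g' x v) k"
    by (rule higher_differentiable_on_SucE) blast
  show ?case
    by (rule higher_differentiable_on_SucI[OF has_derivative[OF g(1)]]) (intro Suc.IH g)
qed

lemma higher_differentiable_on_ident: "higher_differentiable_on UNIV (\<lambda>x. x) k"
  by (cases k) (auto intro!: higher_differentiable_on_SucI[where f' = "\<lambda>x v. v"]
      higher_differentiable_on_const simp del: higher_differentiable_on.simps(2))

lemma higher_differentiable_on_add:
  "higher_differentiable_on UNIV f k \<Longrightarrow> higher_differentiable_on UNIV g k \<Longrightarrow>
    higher_differentiable_on UNIV (\<lambda>x. f x + g x) k"
proof (induction k arbitrary: f g)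
  case (Suc k)
  from Suc.prems(1) obtain f' where f: "\<And>x. (f has_derivative f' x) (at x)"
      "\<And>v. higher_differentiable_on UNIV (\<lambda>x. f' x v) k"
    by (rule higher_differentiable_on_SucE) blast
  from Suc.prems(2) obtain g' where g: "\<And>x. (g has_derivative g' x) (at x)"
      "\<And>v. higher_differentiable_on UNIV (\<lambda>x. g' x v) k"
    by (rule higher_differentiable_on_SucE) blast
  show ?case
    by (rule higher_differentiable_on_SucI[OF has_derivative_add[OF f(1) g(1)]])
       (intro Suc.IH f g)
qed (auto intro: continuous_intros)

text \<open>In the Leibniz rule each summand keeps one factor undifferentiated, so the induction
  also needs that factor at the lower order.\<close>

lemma (in bounded_bilinear) higher_differentiable_on_prod:
  "higher_differentiable_on UNIV f k \<Longrightarrow> higher_differentiable_on UNIV g k \<Longrightarrow>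
    higher_differentiable_on UNIV (\<lambda>x. prod (f x) (g x)) k"
proof (induction k arbitrary: f g)
  case 0
  then show ?case by (auto intro: continuous_on)
next
  case (Suc k)
  from Suc.prems(1) obtain f' where f: "\<And>x. (f has_derivative f' x) (at x)"
      "\<And>v. higher_differentiable_on UNIV (\<lambda>x. f' x v) k"
    by (rule higher_differentiable_on_SucE) blast
  from Suc.prems(2) obtain g' where g: "\<And>x. (g has_derivative g' x) (at x)"
      "\<And>v. higher_differentiable_on UNIV (\<lambda>x. g' x v) k"
    by (rule higher_differentiable_on_SucE) blast
  show ?case
    by (rule higher_differentiable_on_SucI[OF FDERIV[OF f(1) g(1)]])
       (intro higher_differentiable_on_add Suc.IH f g Suc.prems[THEN higher_differentiable_on_SucD])
qed

text \<open>Differentiation lowers the exponent by one, so the induction must leave \<open>a\<close>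
  arbitrary.\<close>

lemma higher_differentiable_on_powr:
  fixes f :: "'a::real_normed_vector \<Rightarrow> real"
  assumes pos: "\<And>x. f x > 0"
  shows "higher_differentiable_on UNIV f k \<Longrightarrow>
    higher_differentiable_on UNIV (\<lambda>x. f x powr a) k"
proof (induction k arbitrary: a)
  case 0
  then show ?case using pos by (auto intro!: continuous_intros simp: less_imp_neq[symmetric])
next
  case (Suc k)
  from Suc.prems obtain f' where f: "\<And>x. (f has_derivative f' x) (at x)"
      "\<And>v. higher_differentiable_on UNIV (\<lambda>x. f' x v) k"
    by (rule higher_differentiable_on_SucE) blast
  have "((\<lambda>x. f x powr a) has_derivative (\<lambda>v. f x powr (a - 1) * (a * f' x v))) (at x)" for x
  proof -
    have "((\<lambda>y. y powr a) has_derivative (\<lambda>h. a * f x powr (a - 1) * h)) (at (f x))"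
      using has_real_derivative_powr[OF pos[of x], of a] by (simp add: has_field_derivative_def)
    from has_derivative_compose[OF f(1) this] show ?thesis by (simp add: mult_ac)
  qed
  then show ?case
    by (rule higher_differentiable_on_SucI)
       (intro bounded_bilinear.higher_differentiable_on_prod[OF bounded_bilinear_mult]
          higher_differentiable_on_const Suc.IH Suc.prems[THEN higher_differentiable_on_SucD] f(2))
qed

text \<open>Curves of this shape are closed under differentiation, with new coefficient vectors;
  hence \<open>u\<close> and \<open>v\<close> vary in the induction.\<close>

lemma higher_differentiable_on_trig_curve:
  fixes u v :: "'a::real_normed_vector"
  shows "higher_differentiable_on UNIV (\<lambda>t. cos (w * t) *\<^sub>R u + sin (w * t) *\<^sub>R v) k"
proof (induction k arbitrary: u v)
  case 0
  show ?case by (auto intro!: continuous_intros)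
next
  case (Suc k)
  have "((\<lambda>t. cos (w * t) *\<^sub>R u + sin (w * t) *\<^sub>R v) has_derivative
      (\<lambda>h. cos (w * t) *\<^sub>R ((h * w) *\<^sub>R v) + sin (w * t) *\<^sub>R ((- h * w) *\<^sub>R u))) (at t)" for t
    by (auto intro!: derivative_eq_intros simp: algebra_simps)
  then show ?case by (rule higher_differentiable_on_SucI) (rule Suc.IH)
qed

section \<open>The Hamiltonian\<close>

definition ang :: "'n::finite \<Rightarrow> 'n \<Rightarrow> complex ^ 'n \<Rightarrow> real" where
  "ang a b z = Re (z $ a) * Im (z $ b) - Re (z $ b) * Im (z $ a)"

definition dang :: "'n::finite \<Rightarrow> 'n \<Rightarrow> complex ^ 'n \<Rightarrow> complex ^ 'n \<Rightarrow> real" where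
  "dang a b z v = Re (v $ a) * Im (z $ b) + Re (z $ a) * Im (v $ b)
     - (Re (v $ b) * Im (z $ a) + Re (z $ b) * Im (v $ a))"

definition ham :: "real \<Rightarrow> 'n::finite \<Rightarrow> 'n \<Rightarrow> complex ^ 'n \<Rightarrow> real" where
  "ham B a b z = (z \<bullet> z)\<^sup>2 + B * (ang a b z)\<^sup>2"

definition dham :: "real \<Rightarrow> 'n::finite \<Rightarrow> 'n \<Rightarrow> complex ^ 'n \<Rightarrow> complex ^ 'n \<Rightarrow> real" where
  "dham B a b z v = 4 * (z \<bullet> z) * (z \<bullet> v) + 2 * B * ang a b z * dang a b z v"

definition imul :: "complex ^ 'n::finite \<Rightarrow> complex ^ 'n" where
  "imul z = (\<chi> j. \<i> * z $ j)"

text \<open>For distinct \<open>a\<close> and \<open>b\<close> this is the infinitesimal rotation of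
  the real (a, b)-plane, acting alike on the x and the y parts. It is the Hamiltonian direction of
  \<open>ang\<close>: applying \<open>imul\<close> to it gives minus the gradient of
  \<open>ang\<close>.\<close>

definition rot :: "'n::finite \<Rightarrow> 'n \<Rightarrow> complex ^ 'n \<Rightarrow> complex ^ 'n" where
  "rot a b z = axis a (z $ b) - axis b (z $ a)"

text \<open>Half the Hamiltonian vector field of \<open>ham\<close>, where the field X of H
  satisfies d(lambda0)(X, v) = -dH(v). The half makes \<open>lambda0 z (ham_field B a b z)\<close>
  equal to \<open>ham B a b z\<close>, hence to 1 on the boundary.\<close>

definition ham_field :: "real \<Rightarrow> 'n::finite \<Rightarrow> 'n \<Rightarrow> complex ^ 'n \<Rightarrow> complex ^ 'n" where
  "ham_field B a b z = (2 * (z \<bullet> z)) *\<^sub>R imul z + (B * ang a b z) *\<^sub>R rot a b z"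

lemmas has_derivative_vec_nth = bounded_linear.has_derivative[OF bounded_linear_vec_nth]

lemma ang_has_derivative: "(ang a b has_derivative dang a b z) (at z)"
  unfolding ang_def[abs_def] dang_def[abs_def]
  by (auto intro!: derivative_eq_intros has_derivative_vec_nth
      simp: algebra_simps)

lemma ham_has_derivative: "(ham B a b has_derivative dham B a b z) (at z)"
  unfolding ham_def[abs_def] dham_def[abs_def]
  by (auto intro!: derivative_eq_intros ang_has_derivative
      simp: algebra_simps inner_commute power2_eq_square)

section \<open>Homogeneity and positivity of the Hamiltonian\<close>

lemma ang_scaleR: "ang a b (t *\<^sub>R z) = t\<^sup>2 * ang a b z"
  by (simp add: ang_def algebra_simps power2_eq_square)

lemma ham_scaleR: "ham B a b (t *\<^sub>R z) = t ^ 4 * ham B a b z"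
  by (simp add: ham_def ang_scaleR power_mult_distrib power4_eq_xxxx power2_eq_square algebra_simps)

lemma dang_self: "dang a b z z = 2 * ang a b z"
  by (simp add: dang_def ang_def algebra_simps)

text \<open>Euler's identity in degree four. It makes the radial direction transverse to the level
  set and fixes the normalisation of the Reeb field.\<close>

lemma dham_self: "dham B a b z z = 4 * ham B a b z"
  by (simp add: dham_def ham_def dang_self power2_eq_square algebra_simps)

lemma ham_nonneg: "B \<ge> 0 \<Longrightarrow> ham B a b z \<ge> 0"
  by (simp add: ham_def)

lemma ham_pos: "B \<ge> 0 \<Longrightarrow> z \<noteq> 0 \<Longrightarrow> ham B a b z > 0"
  by (simp add: ham_def add_pos_nonneg)

lemma continuous_on_ham: "continuous_on S (ham B a b)"
  by (meson continuous_at_imp_continuous_on ham_has_derivative has_derivative_continuous)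

lemma linear_dham: "linear (dham B a b z)"
  using ham_has_derivative has_derivative_linear by blast

lemma higher_differentiable_on_ham_compose:
  assumes "higher_differentiable_on UNIV f k"
  shows "higher_differentiable_on UNIV (\<lambda>x. ham B a b (f x)) k"
proof -
  note intros = higher_differentiable_on_add higher_differentiable_on_const
    bounded_bilinear.higher_differentiable_on_prod[OF bounded_bilinear_mult]
    bounded_bilinear.higher_differentiable_on_prod[OF bounded_bilinear_inner]
    bounded_linear.higher_differentiable_on_compose[OF bounded_linear_Re]
    bounded_linear.higher_differentiable_on_compose[OF bounded_linear_Im]
    bounded_linear.higher_differentiable_on_compose[OF bounded_linear_vec_nth] assms
  have "higher_differentiable_on UNIV (\<lambda>x. ang a b (f x)) k"
    \<comment> \<open>The minus sign is moved into the complex argument, so that only sums, products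
      and bounded linear maps remain.\<close>
    unfolding ang_def diff_conv_add_uminus mult_minus_left[symmetric] uminus_complex.sel[symmetric]
    by (intro intros bounded_linear.higher_differentiable_on_compose[OF bounded_linear_minus[OF bounded_linear_ident]])
  then show ?thesis
    unfolding ham_def power2_eq_square by (intro intros)
qed

section \<open>The domain and its boundary\<close>

definition ham_dom :: "real \<Rightarrow> 'n::finite \<Rightarrow> 'n \<Rightarrow> (complex ^ 'n) set" where
  "ham_dom B a b = {z. ham B a b z \<le> 1}"

text \<open>An interior point stays in the domain when scaled by some t > 1, which multiplies
  \<open>ham\<close> by t^4; so its value lies strictly below 1.\<close>

lemma frontier_ham_dom:
  assumes "B \<ge> 0"
  shows "frontier (ham_dom B a b) = {z. ham B a b z = 1}"
proof -
  have "open {z. ham B a b z < 1}"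
    by (intro open_Collect_less continuous_on_ham continuous_intros)
  then have "{z. ham B a b z < 1} \<subseteq> interior (ham_dom B a b)"
    by (intro interior_maximal) (auto simp: ham_dom_def)
  moreover have "ham B a b z < 1" if z: "z \<in> interior (ham_dom B a b)" for z
  proof (rule ccontr)
    assume "\<not> ham B a b z < 1"
    then have "ham B a b z \<ge> 1" by simp
    have "((\<lambda>t. t *\<^sub>R z) \<longlongrightarrow> 1 *\<^sub>R z) (at_right (1::real))"
      by (intro tendsto_intros)
    then have "\<forall>\<^sub>F t in at_right 1. t *\<^sub>R z \<in> interior (ham_dom B a b)"
      using z by (intro topological_tendstoD) auto
    moreover have "\<forall>\<^sub>F t::real in at_right 1. t > 1"
      by (simp add: eventually_at_right_less)
    ultimately have "\<forall>\<^sub>F t in at_right (1::real). t > 1 \<and> t *\<^sub>R z \<in> interior (ham_dom B a b)"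
      by eventually_elim simp
    then obtain t :: real where t: "t > 1" "t *\<^sub>R z \<in> interior (ham_dom B a b)"
      using eventually_happens' trivial_limit_at_right_real by blast
    then have "t ^ 4 * ham B a b z \<le> 1"
      using interior_subset by (fastforce simp: ham_dom_def ham_scaleR)
    moreover have "t ^ 4 > 1" using t by simp
    ultimately show False using \<open>ham B a b z \<ge> 1\<close>
      by (metis less_le_trans mult.right_neutral mult_left_mono not_less order_less_imp_le zero_less_one order_trans)
  qed
  moreover have "closed (ham_dom B a b)"
    unfolding ham_dom_def by (intro closed_Collect_le continuous_on_ham continuous_intros)
  ultimately have "interior (ham_dom B a b) = {z. ham B a b z < 1}" "closed (ham_dom B a b)"
    by auto
  then show ?thesis
    by (auto simp: frontier_def ham_dom_def)
qed

lemma compact_ham_dom: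
  assumes "B \<ge> 0"
  shows "compact (ham_dom B a b)"
proof -
  have "closed (ham_dom B a b)"
    unfolding ham_dom_def by (intro closed_Collect_le continuous_on_ham continuous_intros)
  moreover have "norm z \<le> 1" if "z \<in> ham_dom B a b" for z
  proof -
    have "(norm z) ^ 4 + B * (ang a b z)\<^sup>2 \<le> 1"
      using that by (simp add: ham_dom_def ham_def power2_norm_eq_inner[symmetric])
    moreover have "B * (ang a b z)\<^sup>2 \<ge> 0" using assms by simp
    ultimately have "(norm z) ^ 4 \<le> 1 ^ 4" by simp
    then show ?thesis using power_mono_iff[of "norm z" 1 4] by simp
  qed
  ultimately show ?thesis
    by (auto simp: compact_eq_bounded_closed bounded_iff)
qed

lemma connected_ham_dom:
  assumes "B \<ge> 0"
  shows "connected (ham_dom B a b)"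
proof -
  have "t *\<^sub>R z \<in> ham_dom B a b" if "z \<in> ham_dom B a b" "0 \<le> t" "t \<le> 1" for t z
    using that mult_le_one[of "t ^ 4" "ham B a b z"] ham_nonneg[OF assms, of a b z]
    by (simp add: ham_dom_def ham_scaleR power_le_one)
  then have "starlike (ham_dom B a b)"
    unfolding starlike_def
    by (intro bexI[of _ 0]) (auto simp: closed_segment_def ham_dom_def ham_def ang_def)
  then show ?thesis by (rule starlike_imp_connected)
qed

text \<open>One inclusion differentiates the constant \<open>ham\<close> along a curve. For the
  other, the line through \<open>p\<close> in direction \<open>v\<close> is projected radially onto
  the level set, which gives an explicit smooth curve.\<close>

lemma tangent_space_ham_level:
  assumes "B \<ge> 0" and p: "ham B a b p = 1"
  shows "tangent_space {z. ham B a b z = 1} p = {v. dham B a b p v = 0}"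
proof (intro equalityI subsetI)
  fix v assume "v \<in> tangent_space {z. ham B a b z = 1} p"
  then obtain \<gamma> \<epsilon> where \<gamma>: "0 < \<epsilon>" "\<gamma> ` {-\<epsilon><..<\<epsilon>} \<subseteq> {z. ham B a b z = 1}" "\<gamma> 0 = p"
      "(\<gamma> has_vector_derivative v) (at (0::real))"
    by (auto simp: tangent_space_def)
  have "((\<lambda>t. ham B a b (\<gamma> t)) has_derivative (\<lambda>h. dham B a b p (h *\<^sub>R v))) (at 0)"
    using has_derivative_compose[OF \<gamma>(4)[unfolded has_vector_derivative_def] ham_has_derivative]
      \<gamma>(3) by simp
  moreover have "((\<lambda>t. ham B a b (\<gamma> t)) has_derivative (\<lambda>h. 0)) (at 0)"
    by (rule has_derivative_transform_within_open[of "\<lambda>t. 1" _ _ _ "{-\<epsilon><..<\<epsilon>}"])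
       (use \<gamma> in \<open>auto simp: image_subset_iff\<close>)
  ultimately have "(\<lambda>h. dham B a b p (h *\<^sub>R v)) = (\<lambda>h. 0)"
    by (rule has_derivative_unique)
  then have "dham B a b p (1 *\<^sub>R v) = 0" by metis
  then show "v \<in> {v. dham B a b p v = 0}" by simp
next
  fix v assume "v \<in> {v. dham B a b p v = 0}"
  then have v: "dham B a b p v = 0" by simp
  \<comment> \<open>If the line met the origin, \<open>p\<close> would be a multiple of
    \<open>v\<close> and hence in the kernel of \<open>dham B a b p\<close>, against Euler's
    identity.\<close>
  have ne: "p + t *\<^sub>R v \<noteq> 0" for t
  proof
    assume "p + t *\<^sub>R v = 0"
    then have "p = (- t) *\<^sub>R v" by (simp add: add_eq_0_iff)
    then have "dham B a b p p = (- t) * dham B a b p v"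
      by (metis linear_cmul[OF linear_dham] real_scaleR_def)
    then show False using v p dham_self[of B a b p] by simp
  qed
  define h where "h t = ham B a b (p + t *\<^sub>R v)" for t
  have pos: "h t > 0" for t
    unfolding h_def by (intro ham_pos assms ne)
  \<comment> \<open>The exponent -1/4 compensates the homogeneity of degree four.\<close>
  define \<gamma> where "\<gamma> t = (h t powr (-1/4)) *\<^sub>R (p + t *\<^sub>R v)" for t
  have line: "higher_differentiable_on UNIV (\<lambda>t. p + t *\<^sub>R v) k" for k
    by (intro higher_differentiable_on_add higher_differentiable_on_const
        bounded_linear.higher_differentiable_on_compose[OF bounded_linear_scaleR_left]
        higher_differentiable_on_ident)
  have "smooth_on UNIV \<gamma>"
    unfolding smooth_on_def \<gamma>_def
    by (intro allI bounded_bilinear.higher_differentiable_on_prod[OF bounded_bilinear_scaleR] line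
        higher_differentiable_on_powr pos)
       (unfold h_def, intro higher_differentiable_on_ham_compose line)
  moreover have "ham B a b (\<gamma> t) = 1" for t
    using pos[of t]
    by (simp add: \<gamma>_def ham_scaleR powr_power h_def[symmetric] del: powr_minus_divide)
  moreover have h0: "h 0 = 1" using p by (simp add: h_def)
  then have "\<gamma> 0 = p" by (simp add: \<gamma>_def)
  \<comment> \<open>Since \<open>v\<close> is in the kernel, \<open>h\<close> is stationary at 0;
    the scaling factor does not affect the velocity there.\<close>
  moreover have "(\<gamma> has_vector_derivative v) (at 0)"
  proof -
    have "((\<lambda>t. p + t *\<^sub>R v) has_derivative (\<lambda>t. t *\<^sub>R v)) (at 0)"
      by (auto intro!: derivative_eq_intros)
    from has_derivative_compose[OF this, OF ham_has_derivative[of B a b]]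
    have "(h has_derivative (\<lambda>t. 0)) (at 0)"
      using v by (simp add: h_def[abs_def] linear_cmul[OF linear_dham])
    then have "(h has_real_derivative 0) (at 0)"
      by (simp add: has_field_derivative_def lambda_zero)
    then have "((\<lambda>t. h t powr (-1/4)) has_real_derivative 0) (at 0)"
      using pos[of 0] by (auto intro!: derivative_eq_intros)
    moreover have "((\<lambda>t. p + t *\<^sub>R v) has_vector_derivative v) (at 0)"
      by (auto intro!: derivative_eq_intros simp: has_vector_derivative_def)
    ultimately have "(\<gamma> has_vector_derivative h 0 powr (-1/4) *\<^sub>R v + 0 *\<^sub>R (p + 0 *\<^sub>R v)) (at 0)"
      unfolding \<gamma>_def[abs_def] by (rule has_vector_derivative_scaleR)
    then show ?thesis by (simp add: h0)
  qed
  ultimately show "v \<in> tangent_space {z. ham B a b z = 1} p"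
    unfolding tangent_space_def
    by (auto intro!: exI[of _ \<gamma>] exI[of _ "1::real"] intro: smooth_on_subset)
qed

lemma starshaped_ham_dom:
  assumes "B \<ge> 0"
  shows "starshaped_domain (ham_dom B a b)"
proof -
  have "\<exists>U f. open U \<and> p \<in> U \<and> smooth_on U (f :: _ \<Rightarrow> real) \<and>
        (\<exists>v. frechet_derivative f (at p) v \<noteq> 0) \<and> ham_dom B a b \<inter> U = {x \<in> U. f x \<le> 0}"
    if "p \<in> frontier (ham_dom B a b)" for p
  proof (intro exI conjI)
    have D: "((\<lambda>z. ham B a b z + (-1)) has_derivative dham B a b p) (at p)"
      by (auto intro!: derivative_eq_intros ham_has_derivative)
    \<comment> \<open>The radial vector \<open>p\<close> is the witness: the derivative along it is
      4.\<close>
    show "frechet_derivative (\<lambda>z. ham B a b z + (-1)) (at p) p \<noteq> 0"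
      unfolding frechet_derivative_at[OF D, symmetric]
      using that by (simp add: dham_self frontier_ham_dom[OF assms])
    show "smooth_on UNIV (\<lambda>z. ham B a b z + (-1))"
      unfolding smooth_on_def
      by (intro allI higher_differentiable_on_add higher_differentiable_on_const
          higher_differentiable_on_ham_compose higher_differentiable_on_ident)
  qed (auto simp: ham_dom_def)
  moreover have "0 \<in> interior (ham_dom B a b)"
  proof -
    have "0 \<in> ham_dom B a b" "0 \<notin> frontier (ham_dom B a b)"
      unfolding frontier_ham_dom[OF assms] by (auto simp: ham_dom_def ham_def ang_def)
    then show ?thesis using closure_subset by (auto simp: frontier_def)
  qed
  moreover have "p \<notin> tangent_space (frontier (ham_dom B a b)) p" if "p \<in> frontier (ham_dom B a b)" for p
    using that assms by (simp add: frontier_ham_dom tangent_space_ham_level dham_self)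
  ultimately show ?thesis
    using assms by (simp add: starshaped_domain_def smooth_compact_domain_def compact_ham_dom connected_ham_dom)
qed

lemma ang_conjugation: "ang a b (conjugation z) = - ang a b z"
  by (simp add: ang_def conjugation_def)

text \<open>Conjugation preserves the norm and flips the sign of \<open>ang\<close>, which enters
  \<open>ham\<close> only through its square.\<close>

lemma conjugation_ham_dom: "conjugation ` ham_dom B a b = ham_dom B a b"
proof -
  have "ham B a b (conjugation z) = ham B a b z" for z
    by (simp add: ham_def ang_conjugation) (simp add: conjugation_def inner_vec_def inner_complex_def)
  then have "conjugation z \<in> ham_dom B a b" if "z \<in> ham_dom B a b" for z
    using that by (simp add: ham_dom_def)
  moreover have "conjugation (conjugation z) = z" for z :: "complex ^ 'n::finite"
    by (simp add: conjugation_def vec_eq_iff)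
  ultimately show ?thesis by (metis image_subsetI image_eqI subsetI subset_antisym)
qed

section \<open>The Reeb vector field\<close>

lemma linear_imul: "linear imul"
  by (auto intro!: linearI simp: imul_def vec_eq_iff algebra_simps)

lemma lambda0_eq_inner: "lambda0 u v = (1/2) * (imul u \<bullet> v)"
  by (simp add: lambda0_def inner_vec_def inner_complex_def imul_def sum_subtractf algebra_simps)

lemma lambda0_commute: "lambda0 u v = - lambda0 v u"
  by (simp add: lambda0_def sum_subtractf algebra_simps)

text \<open>The coefficients of \<open>lambda0\<close> are linear in the base point, so each is its
  own derivative; antisymmetry produces the factor 2.\<close>

lemma ext_deriv_lambda0:
  fixes p :: "complex ^ 'n::finite"
  shows "ext_deriv lambda0 p u v = 2 * lambda0 u v"
proof -
  have "((\<lambda>q. lambda0 q v) has_derivative (\<lambda>u. lambda0 u v)) (at p)" for v :: "complex ^ 'n"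
  proof -
    have "linear (\<lambda>q. lambda0 q v)"
      unfolding lambda0_eq_inner
      by (intro linearI) (auto simp: linear_add[OF linear_imul] linear_cmul[OF linear_imul] algebra_simps)
    then show ?thesis
      by (intro bounded_linear_imp_has_derivative) (simp add: linear_conv_bounded_linear)
  qed
  note D = this
  show ?thesis
    unfolding ext_deriv_def frechet_derivative_at[OF D, symmetric]
    by (simp add: lambda0_commute[of v u])
qed

lemma imul_axis: "imul (axis j c) = axis j (\<i> * c)"
  by (simp add: imul_def axis_def vec_eq_iff)

lemma lambda0_ham_field: "lambda0 (ham_field B a b z) v = - dham B a b z v / 4"
proof -
  have "imul (imul z) = - z"
    by (simp add: imul_def vec_eq_iff)
  moreover have "imul (rot a b z) \<bullet> v = - dang a b z v"
    by (simp add: rot_def linear_diff[OF linear_imul] imul_axis inner_commute[of _ v] inner_axis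
        dang_def inner_complex_def algebra_simps)
  ultimately show ?thesis
    by (simp add: lambda0_eq_inner ham_field_def linear_add[OF linear_imul]
        linear_cmul[OF linear_imul] dham_def algebra_simps)
qed

text \<open>Since \<open>reeb\<close> is a definite description, uniqueness must be shown too: the
  pairings of a candidate with tangent vectors and with \<open>p\<close> are prescribed, and
  \<open>lambda0\<close> is nondegenerate as a bilinear form.\<close>

lemma reeb_ham_level:
  assumes "B \<ge> 0" and p: "ham B a b p = 1"
  shows "reeb {z. ham B a b z = 1} lambda0 p = ham_field B a b p"
  unfolding reeb_def tangent_space_ham_level[OF assms]
proof (rule the_equality)
  have "lambda0 (ham_field B a b p) (ham_field B a b p) = 0"
    using lambda0_commute[of "ham_field B a b p" "ham_field B a b p"] by simp
  then show "ham_field B a b p \<in> {v. dham B a b p v = 0} \<and>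
      (\<forall>v\<in>{v. dham B a b p v = 0}. ext_deriv lambda0 p (ham_field B a b p) v = 0) \<and>
      lambda0 p (ham_field B a b p) = 1"
    by (auto simp: ext_deriv_lambda0 lambda0_ham_field lambda0_commute[of p] dham_self p)
next
  fix r assume r: "r \<in> {v. dham B a b p v = 0} \<and>
      (\<forall>v\<in>{v. dham B a b p v = 0}. ext_deriv lambda0 p r v = 0) \<and> lambda0 p r = 1"
  have "lambda0 r v = lambda0 (ham_field B a b p) v" for v
  proof -
    \<comment> \<open>By Euler's identity, subtracting \<open>c\<close> times \<open>p\<close>
      leaves a tangent vector.\<close>
    define c where "c = dham B a b p v / 4"
    have "dham B a b p (v - c *\<^sub>R p) = 0"
      by (simp add: linear_diff[OF linear_dham] linear_cmul[OF linear_dham] dham_self p c_def)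
    then have "lambda0 r (v - c *\<^sub>R p) = 0"
      using r by (simp add: ext_deriv_lambda0)
    then have "lambda0 r v = c * lambda0 r p"
      by (simp add: lambda0_eq_inner algebra_simps)
    also have "lambda0 r p = - 1" using r lambda0_commute[of r p] by simp
    finally show ?thesis by (simp add: lambda0_ham_field c_def)
  qed
  then have "imul r = imul (ham_field B a b p)"
    by (intro vector_eq_rdot[THEN iffD1]) (simp add: lambda0_eq_inner)
  then show "r = ham_field B a b p"
    by (simp add: imul_def vec_eq_iff)
qed

section \<open>Periodic orbits\<close>

text \<open>Conservation of angular momentum: \<open>ang\<close> is the imaginary part of
  \<open>cnj (z $ a) * z $ b\<close>, hence invariant under a common phase, and it is constant along
  its own Hamiltonian direction \<open>rot\<close>.\<close>

lemma dang_ham_field: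
  assumes "a \<noteq> b"
  shows "dang a b z (ham_field B a b z) = 0"
  using assms
  by (simp add: dang_def ham_field_def imul_def rot_def axis_def algebra_simps)

lemma symmetric_orbit_period_ge_pi:
  assumes "B \<ge> 0" "a \<noteq> b"
    and orbit: "periodic_orbit (frontier (ham_dom B a b)) lambda0 \<tau> \<gamma>"
    and sym: "symmetric_orbit conjugation \<gamma>"
  shows "\<tau> \<ge> pi"
proof -
  have level: "ham B a b (\<gamma> t) = 1" for t
    using orbit by (auto simp: periodic_orbit_def frontier_ham_dom[OF assms(1)] image_subset_iff)
  have D: "(\<gamma> has_vector_derivative ham_field B a b (\<gamma> t)) (at t)" for t
    using orbit unfolding periodic_orbit_def frontier_ham_dom[OF assms(1)]
    by (metis reeb_ham_level[OF assms(1) level])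
  have "((\<lambda>t. ang a b (\<gamma> t)) has_derivative (\<lambda>h. 0)) (at t)" for t
  proof -
    have "dang a b (\<gamma> t) (h *\<^sub>R ham_field B a b (\<gamma> t)) = 0" for h
      using dang_ham_field[OF assms(2), of "\<gamma> t" B] ang_has_derivative[THEN has_derivative_linear, THEN linear_cmul]
      by (metis scale_zero_right)
    then show ?thesis
      using has_derivative_compose[OF D[of t, unfolded has_vector_derivative_def] ang_has_derivative[of a b]]
      by simp
  qed
  then have ang_const: "ang a b (\<gamma> s) = ang a b (\<gamma> t)" for s t
    using has_derivative_zero_unique[of UNIV "\<lambda>t. ang a b (\<gamma> t)" 0] by (metis UNIV_I convex_UNIV)
  \<comment> \<open>The conjugate of the starting point lies on the orbit, where \<open>ang\<close>
    is constant, yet it carries the opposite value; so this constant is 0.\<close>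
  obtain s where "conjugation (\<gamma> 0) = \<gamma> s"
    using sym unfolding symmetric_orbit_def by (blast intro: rangeI)
  then have ang0: "ang a b (\<gamma> t) = 0" for t
    using ang_conjugation[of a b "\<gamma> 0"] ang_const[of s 0] ang_const[of t 0] by simp
  have "(\<gamma> t \<bullet> \<gamma> t)\<^sup>2 = 1\<^sup>2" for t
    using level[of t] by (simp add: ham_def ang0)
  then have sphere: "\<gamma> t \<bullet> \<gamma> t = 1" for t
    by (metis inner_ge_zero power2_eq_imp_eq zero_le_one)
  then have "\<gamma> 0 \<noteq> 0" by (metis inner_zero_left zero_neq_one)
  \<comment> \<open>A nonzero coordinate is chosen because its phase determines the elapsed time
    modulo pi.\<close>
  then obtain j where j: "\<gamma> 0 $ j \<noteq> 0" by (auto simp: vec_eq_iff)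
  have Dj: "((\<lambda>t. \<gamma> t $ j) has_vector_derivative 2 * \<i> * \<gamma> t $ j) (at t)" for t
    using bounded_linear.has_vector_derivative[OF bounded_linear_vec_nth D[of t], of j]
    by (simp add: ham_field_def ang0 sphere imul_def scaleR_conv_of_real mult_ac)
  \<comment> \<open>Integrating factor for the linear equation in \<open>Dj\<close>.\<close>
  have "((\<lambda>t. cis (- 2 * t) * \<gamma> t $ j) has_vector_derivative 0) (at t)" for t
  proof -
    have "((\<lambda>t. cis (- 2 * t)) has_vector_derivative - (2 * \<i>) * cis (- 2 * t)) (at t)"
      unfolding has_vector_derivative_def
      by (auto intro!: derivative_eq_intros simp: scaleR_conv_of_real)
    from has_vector_derivative_mult[OF this Dj]
    show ?thesis by (simp add: algebra_simps)
  qed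
  then have "cis (- 2 * \<tau>) * \<gamma> \<tau> $ j = cis (- 2 * 0) * \<gamma> 0 $ j"
    using has_vector_derivative_zero_constant[of UNIV "\<lambda>t. cis (- 2 * t) * \<gamma> t $ j"]
    by (metis UNIV_I convex_UNIV)
  moreover have "\<gamma> \<tau> = \<gamma> 0"
    using orbit by (metis add.left_neutral periodic_orbit_def)
  ultimately have "cis (- 2 * \<tau>) = 1" using j by simp
  then have "cos (2 * \<tau>) = 1" by (metis cis.sel(1) cos_minus minus_mult_left one_complex.sel(1))
  then obtain k :: int where k: "2 * \<tau> = k * 2 * pi"
    by (auto simp: cos_one_2pi_int)
  moreover have "\<tau> > 0" using orbit by (simp add: periodic_orbit_def)
  ultimately have "real_of_int k * pi > 0" by simp
  then have "real_of_int k > 0" by (simp add: zero_less_mult_iff)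
  then have "real_of_int k \<ge> 1" by simp
  then show ?thesis using k by simp
qed

lemma short_orbit:
  assumes "B \<ge> 0" "a \<noteq> b"
  shows "\<exists>\<gamma>. periodic_orbit (frontier (ham_dom B a b)) lambda0 (2 * pi / sqrt (4 + B)) \<gamma>"
proof -
  \<comment> \<open>On the circle of vectors \<open>z c\<close> with squared \<open>cmod c\<close>
    equal to 1/w, \<open>ham\<close> takes the value (4 + B)/w^2. This \<open>w\<close> makes it 1,
    and it is also the angular speed.\<close>
  define w where "w = sqrt (4 + B)"
  have w: "w > 0" "w\<^sup>2 = 4 + B" using assms by (auto simp: w_def)
  define s where "s = 1 / sqrt w"
  have s: "s\<^sup>2 = 1 / w" using w by (simp add: s_def power_divide)
  \<comment> \<open>The direction (1, i) is an eigenvector: \<open>rot\<close> acts on it as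
    \<open>imul\<close>, so the two terms of \<open>ham_field\<close> are parallel.\<close>
  define z where "z c = axis a c + axis b (\<i> * c)" for c :: complex
  define \<gamma> where "\<gamma> t = cos (w * t) *\<^sub>R z s + sin (w * t) *\<^sub>R z (\<i> * s)" for t
  have \<gamma>: "\<gamma> t = z (s * cis (w * t))" for t
    by (auto simp: \<gamma>_def z_def vec_eq_iff axis_def complex_eq_iff)
  have D: "(\<gamma> has_vector_derivative w *\<^sub>R imul (\<gamma> t)) (at t)" for t
  proof -
    have "imul (z c) = z (\<i> * c)" "z (- c) = - z c" for c
      by (auto simp: imul_def z_def axis_def vec_eq_iff algebra_simps)
    then have "imul (\<gamma> t) = cos (w * t) *\<^sub>R z (\<i> * s) - sin (w * t) *\<^sub>R z s"
      by (simp add: \<gamma>_def linear_add[OF linear_imul] linear_cmul[OF linear_imul])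
    then have "w *\<^sub>R imul (\<gamma> t) = (w * cos (w * t)) *\<^sub>R z (\<i> * s) - (w * sin (w * t)) *\<^sub>R z s"
      by (simp add: scaleR_diff_right)
    moreover have "(\<gamma> has_vector_derivative
        (w * cos (w * t)) *\<^sub>R z (\<i> * s) - (w * sin (w * t)) *\<^sub>R z s) (at t)"
      unfolding \<gamma>_def[abs_def] has_vector_derivative_def
      by (auto intro!: derivative_eq_intros simp: algebra_simps)
    ultimately show ?thesis by simp
  qed
  have inner: "z c \<bullet> z c = 2 * (cmod c)\<^sup>2" for c
  proof -
    have "z c \<bullet> v = c \<bullet> v $ a + (\<i> * c) \<bullet> v $ b" for v
      by (simp add: z_def inner_add_left inner_axis')
    moreover have "z c $ a = c" "z c $ b = \<i> * c"
      using assms(2) by (auto simp: z_def axis_def)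
    ultimately have "z c \<bullet> z c = c \<bullet> c + (\<i> * c) \<bullet> (\<i> * c)" by simp
    then show ?thesis by (simp add: dot_square_norm norm_mult)
  qed
  have ang: "ang a b (z c) = (cmod c)\<^sup>2" for c
    using assms(2) unfolding cmod_power2 by (simp add: z_def ang_def axis_def power2_eq_square)
  have rot: "rot a b (z c) = imul (z c)" for c
    using assms(2) by (auto simp: z_def rot_def imul_def axis_def vec_eq_iff)
  have norm: "(cmod (s * cis (w * t)))\<^sup>2 = 1 / w" for t
    by (simp add: norm_mult power_mult_distrib s)
  have "ham B a b (\<gamma> t) = (4 + B) * (1 / w)\<^sup>2" for t
    unfolding ham_def \<gamma> inner ang norm by (simp add: power_mult_distrib algebra_simps power_divide add_divide_distrib)
  then have level: "ham B a b (\<gamma> t) = 1" for t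
    using w assms(1) by (simp add: power_divide)
  have "ham_field B a b (\<gamma> t) = ((4 + B) * (1 / w)) *\<^sub>R imul (\<gamma> t)" for t
    unfolding ham_field_def \<gamma> inner ang norm rot by (simp add: algebra_simps add_divide_distrib)
  \<comment> \<open>The speed is the sum of 4/w from the quartic term and B/w from the angular
    term.\<close>
  also have "(4 + B) * (1 / w) = w" using w by (simp add: field_simps power2_eq_square)
  finally have field: "ham_field B a b (\<gamma> t) = w *\<^sub>R imul (\<gamma> t)" for t .
  have "smooth_on UNIV \<gamma>"
    unfolding smooth_on_def \<gamma>_def by (intro allI higher_differentiable_on_trig_curve)
  moreover have "\<gamma> (t + 2 * pi / w) = \<gamma> t" for t
    using w by (simp add: \<gamma>_def distrib_left)
  ultimately have "periodic_orbit (frontier (ham_dom B a b)) lambda0 (2 * pi / w) \<gamma>"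
    using w D field level assms(1) by (auto simp: periodic_orbit_def frontier_ham_dom reeb_ham_level)
  then show ?thesis unfolding w_def by blast
qed

section \<open>Comparison of the two systoles\<close>

theorem mainTheorem4:
  fixes C :: real
  assumes "CARD('n::finite) \<ge> 2" and "C > 0"
  shows "\<exists>K :: (complex ^ 'n) set.
           starshaped_domain K \<and> conjugation ` K = K \<and>
           symmetric_ratio (frontier K) lambda0 conjugation > ereal C"
proof -
  obtain a b :: 'n where ab: "a \<noteq> b"
    using assms(1) by (metis card_le_Suc0_iff_eq finite not_less_eq_eq numeral_2_eq_2)
  \<comment> \<open>With the short period \<open>T\<close> below, pi/T is half of
    \<open>sqrt (4 + B)\<close>, which this choice makes larger than C.\<close>
  define B where "B = 4 * C\<^sup>2"
  have B: "B \<ge> 0" by (simp add: B_def)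
  define M where "M = frontier (ham_dom B a b)"
  define T where "T = 2 * pi / sqrt (4 + B)"
  have "sqrt (4 * C\<^sup>2) < sqrt (4 + B)" by (simp add: B_def)
  then have C: "2 * C < sqrt (4 + B)" using assms(2) by (simp add: real_sqrt_mult)
  then have T: "T > 0" "C < pi / T"
    using assms(2) B by (auto simp: T_def field_simps)
  \<comment> \<open>The bound also covers an empty set of symmetric orbits, whose infimum is
    \<infinity>.\<close>
  have sym: "symmetric_systole M lambda0 conjugation \<ge> ereal pi"
    unfolding symmetric_systole_def M_def
    using symmetric_orbit_period_ge_pi[OF B ab] by (intro Inf_greatest) auto
  \<comment> \<open>Inversion reverses the order on nonnegative extended reals, the inverse of 0
    being \<infinity>, so an upper bound on the systole bounds the ratio from below.\<close>
  have "systole M lambda0 \<ge> 0"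
    unfolding systole_def by (intro Inf_greatest) (auto simp: periodic_orbit_def)
  moreover have "systole M lambda0 \<le> ereal T"
    unfolding systole_def M_def T_def using short_orbit[OF B ab] by (intro Inf_lower) auto
  ultimately have "inverse (ereal T) \<le> inverse (systole M lambda0)"
    by (rule ereal_inverse_antimono)
  then have "ereal pi * inverse (ereal T) \<le> symmetric_ratio M lambda0 conjugation"
    unfolding symmetric_ratio_def divide_ereal_def using sym T
    by (intro ereal_mult_mono) (auto intro: order_trans[OF _ sym])
  moreover have "ereal C < ereal pi * inverse (ereal T)"
    using T by (simp add: divide_inverse)
  ultimately have "symmetric_ratio M lambda0 conjugation > ereal C" by (rule less_le_trans[rotated])
  then show ?thesis
    unfolding M_def using starshaped_ham_dom[OF B] conjugation_ham_dom by blast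
qed

end
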